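(* Let $n\geq1$, let $M_1(\vec x,\vec y,\vec z)$ and $M_2(\vec x,\vec y,\vec z)$ be $3n$-ary RE relations (with $\vec x,\vec y,\vec z\in\mathbb N^n$), and let $G:\mathbb N^2\to\mathbb N^n$ be a recursive $n$-ary functional on $\mathbb N^2$. Then there are $n$-ary recursive functions $f_1(\vec y)$ and $f_2(\vec y)$ such that for all $\vec y,\vec x\in\mathbb N^n$: (1) $\vec x\in R^n_{f_1(\vec y)}\Leftrightarrow M_1(\vec x,\vec y,G(f_1(\vec y),f_2(\vec y)))$; (2) $\vec x\in R^n_{f_2(\vec y)}\Leftrightarrow M_2(\vec x,\vec y,G(f_1(\vec y),f_2(\vec y)))$.
   Context: $\langle R^n_i:i\in\omega\rangle$ is an acceptable enumeration of all $n$-ary RE relations. An $n$-ary functional on $\mathbb N^k$ is a map $G=(g_1,\dots,g_n):\mathbb N^k\to\mathbb N^n$; it is recursive if each $g_i$ is recursive. *)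

theory Defs
  imports Main
begin

text \<open>
  A point of \<open>\<nat>\<^sup>k\<close> is a list of length \<open>k\<close>. A function \<open>\<nat>\<^sup>k \<rightarrow> \<nat>\<close> is a HOL function on lists of
  which only the values on lists of length \<open>k\<close> matter (rule \<open>cong\<close>); a \<open>k\<close>-ary relation is a set
  of lists, all of length \<open>k\<close>.

  The general recursive functions are generated from the initial functions by composition,
  primitive recursion and minimization of regular functions, so all of them are total.
\<close>

inductive recursive_fun :: "nat \<Rightarrow> (nat list \<Rightarrow> nat) \<Rightarrow> bool" where
  zero: "recursive_fun k (\<lambda>xs. 0)"
| succ: "recursive_fun 1 (\<lambda>xs. Suc (xs ! 0))"
| proj: "i < k \<Longrightarrow> recursive_fun k (\<lambda>xs. xs ! i)"
| comp: "recursive_fun (length gs) f \<Longrightarrow> (\<And>g. g \<in> set gs \<Longrightarrow> recursive_fun k g) \<Longrightarrow>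
    recursive_fun k (\<lambda>xs. f (map (\<lambda>g. g xs) gs))"
| prec: "recursive_fun k f \<Longrightarrow> recursive_fun (k + 2) g \<Longrightarrow>
    recursive_fun (k + 1)
      (\<lambda>xs. rec_nat (f (tl xs)) (\<lambda>i r. g (i # r # tl xs)) (hd xs))"
| mu: "recursive_fun (k + 1) f \<Longrightarrow> (\<And>xs. length xs = k \<Longrightarrow> \<exists>t. f (t # xs) = 0) \<Longrightarrow>
    recursive_fun k (\<lambda>xs. LEAST t. f (t # xs) = 0)"
| cong: "recursive_fun k f \<Longrightarrow> (\<And>xs. length xs = k \<Longrightarrow> g xs = f xs) \<Longrightarrow> recursive_fun k g"

definition recursive_rel :: "nat \<Rightarrow> nat list set \<Rightarrow> bool" where
  "recursive_rel k A \<longleftrightarrow>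
     A \<subseteq> {xs. length xs = k} \<and> recursive_fun k (\<lambda>xs. if xs \<in> A then 1 else 0)"

definition RE :: "nat \<Rightarrow> nat list set \<Rightarrow> bool" where
  "RE k A \<longleftrightarrow> (\<exists>B. recursive_rel (k + 1) B \<and> A = {xs. \<exists>t. t # xs \<in> B})"

definition recursive_functional :: "nat \<Rightarrow> nat \<Rightarrow> (nat list \<Rightarrow> nat list) \<Rightarrow> bool" where
  "recursive_functional k n G \<longleftrightarrow>
     (\<forall>xs. length xs = k \<longrightarrow> length (G xs) = n) \<and>
     (\<forall>i<n. recursive_fun k (\<lambda>xs. G xs ! i))"

definition uniformly_RE :: "nat \<Rightarrow> (nat \<Rightarrow> nat list set) \<Rightarrow> bool" where
  "uniformly_RE n S \<longleftrightarrow> RE (n + 1) {i # xs | i xs. xs \<in> S i}"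

text \<open>
  Acceptability of an enumeration of all \<open>n\<close>-ary RE relations: the enumeration theorem (the
  relation \<open>xs \<in> R i\<close> in \<open>i\<close> and \<open>xs\<close> is RE) together with the parametrization property in its
  one-parameter form (every uniformly RE sequence can be recursively translated into \<open>R\<close>).
  This is the usual notion of an enumeration recursively intertranslatable with a standard
  one, stated without singling out a Goedel numbering of programs: the enumeration theorem
  yields the translation of \<open>R\<close> into the standard enumeration, and parametrization yields the
  translation back.
\<close>

definition acceptable_enumeration :: "nat \<Rightarrow> (nat \<Rightarrow> nat list set) \<Rightarrow> bool" where
  "acceptable_enumeration n R \<longleftrightarrow>
     range R = {A. RE n A} \<and>
     uniformly_RE n R \<and>
     (\<forall>S. uniformly_RE n S \<longrightarrow> (\<exists>h. recursive_fun 1 h \<and> (\<forall>i. S i = R (h [i]))))"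

end

theory Submission
  imports Defs "HOL-Library.Nat_Bijection"
begin

text \<open>
  This is Kleene's second recursion theorem. By parametrization there is a recursive \<open>h\<close> such that
  \<open>x \<in> R (h q)\<close> iff \<open>x\<close>, tagged with \<open>q\<close>, lies in \<open>R e\<close>, where \<open>e\<close> is the first component of \<open>q\<close>.
  The RE set \<open>A\<close> of all \<open>x\<close> tagged with some \<open>q = \<langle>e, \<langle>i, y\<rangle>\<rangle>\<close> and satisfying
  \<open>M\<^sub>i\<^sub>+\<^sub>1(x, y, G(h \<langle>e, \<langle>0, y\<rangle>\<rangle>, h \<langle>e, \<langle>1, y\<rangle>\<rangle>))\<close>, where \<open>i\<close> is \<open>0\<close> or \<open>1\<close>, has an index; taking this
  index for \<open>e\<close>, the functions \<open>f\<^sub>i\<^sub>+\<^sub>1 y = h \<langle>e, \<langle>i, y\<rangle>\<rangle>\<close> are as required. A tag is attached to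
  \<open>x\<close> by pairing it with the first entry of \<open>x\<close>, so that the tagged list is still \<open>n\<close>-ary; this is where \<open>n \<ge> 1\<close> enters.
\<close>

section \<open>Closure properties of recursive functions\<close>

lemma recursive_fun_comp1:
  assumes "recursive_fun 1 f" "recursive_fun k a"
  shows "recursive_fun k (\<lambda>xs. f [a xs])"
  using recursive_fun.comp[of "[a]" f k] assms by auto

lemma recursive_fun_comp2:
  assumes "recursive_fun 2 f" "recursive_fun k a" "recursive_fun k b"
  shows "recursive_fun k (\<lambda>xs. f [a xs, b xs])"
  using recursive_fun.comp[of "[a, b]" f k] assms by (auto simp: numeral_2_eq_2)

lemma recursive_fun_comp3:
  assumes "recursive_fun 3 f" "recursive_fun k a" "recursive_fun k b" "recursive_fun k c"
  shows "recursive_fun k (\<lambda>xs. f [a xs, b xs, c xs])"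
  using recursive_fun.comp[of "[a, b, c]" f k] assms by (auto simp: numeral_3_eq_3)

lemma recursive_fun_Suc:
  assumes "recursive_fun k a"
  shows "recursive_fun k (\<lambda>xs. Suc (a xs))"
  using recursive_fun_comp1[OF recursive_fun.succ assms] by simp

lemma recursive_fun_const: "recursive_fun k (\<lambda>xs. c)"
  by (induction c) (auto intro: recursive_fun.zero recursive_fun_Suc)

lemma recursive_fun_hd:
  assumes "k \<ge> 1"
  shows "recursive_fun k hd"
  by (rule recursive_fun.cong[OF recursive_fun.proj[of 0]]) (use assms in \<open>auto intro!: hd_conv_nth\<close>)

lemma recursive_fun_add:
  assumes "recursive_fun k a" "recursive_fun k b"
  shows "recursive_fun k (\<lambda>xs. a xs + b xs)"
proof -
  have rec: "rec_nat m (\<lambda>i r. Suc r) j = j + m" for m j :: nat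
    by (induction j) auto
  have "recursive_fun 2 (\<lambda>xs. rec_nat (tl xs ! 0) (\<lambda>i r. Suc r) (hd xs))"
    using recursive_fun.prec[of 1 "\<lambda>xs. xs ! 0" "\<lambda>xs. Suc (xs ! 1)"]
    by (simp add: recursive_fun.proj recursive_fun_Suc numeral_2_eq_2)
  from recursive_fun_comp2[OF this assms] show ?thesis by (simp add: rec)
qed

lemma recursive_fun_pred:
  assumes "recursive_fun k a"
  shows "recursive_fun k (\<lambda>xs. a xs - 1)"
proof -
  have rec: "rec_nat 0 (\<lambda>i r. i) j = j - 1" for j :: nat
    by (cases j) auto
  \<comment> \<open>The step ignores the previous result and returns the counter, which trails the
    argument by one.\<close>
  have "recursive_fun 1 (\<lambda>xs. rec_nat 0 (\<lambda>i r. i) (hd xs))"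
    using recursive_fun.prec[of 0 "\<lambda>xs. 0" "\<lambda>xs. xs ! 0"]
    by (simp add: recursive_fun.proj recursive_fun.zero)
  from recursive_fun_comp1[OF this assms] show ?thesis by (simp add: rec)
qed

lemma recursive_fun_diff:
  assumes "recursive_fun k a" "recursive_fun k b"
  shows "recursive_fun k (\<lambda>xs. a xs - b xs)"
proof -
  have rec: "rec_nat m (\<lambda>i r. r - 1) j = m - j" for m j :: nat
    by (induction j) auto
  have "recursive_fun 2 (\<lambda>xs. rec_nat (tl xs ! 0) (\<lambda>i r. r - 1) (hd xs))"
    using recursive_fun.prec[of 1 "\<lambda>xs. xs ! 0" "\<lambda>xs. xs ! 1 - 1"]
    by (simp add: recursive_fun.proj recursive_fun_pred[simplified] numeral_2_eq_2)
  \<comment> \<open>The recursion runs on the subtrahend, iterating the predecessor, so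
    \<open>b\<close> is passed before \<open>a\<close>.\<close>
  from recursive_fun_comp2[OF this assms(2,1)] show ?thesis by (simp only: rec list.sel nth_Cons_0)
qed

lemma recursive_fun_if_zero:
  assumes "recursive_fun k c" "recursive_fun k a" "recursive_fun k b"
  shows "recursive_fun k (\<lambda>xs. if c xs = 0 then a xs else b xs)"
proof -
  have rec: "rec_nat m (\<lambda>i r. l) j = (if j = 0 then m else l)" for m l j :: nat
    by (cases j) auto
  \<comment> \<open>Position 3 of \<open>i # r # tl xs\<close> holds the third argument, the value
    of \<open>b\<close>. The step returns it whatever \<open>i\<close> and \<open>r\<close> are, so
    the recursion is a mere case split on the first argument.\<close>
  have "recursive_fun 3 (\<lambda>xs. rec_nat (tl xs ! 0) (\<lambda>i r. (i # r # tl xs) ! 3) (hd xs))"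
    using recursive_fun.prec[of 2 "\<lambda>xs. xs ! 0" "\<lambda>xs. xs ! 3"]
    by (simp add: recursive_fun.proj)
  from recursive_fun_comp3[OF this assms] show ?thesis by (simp add: rec)
qed

section \<open>Cantor pairing and its projections\<close>

lemma recursive_fun_triangle:
  assumes "recursive_fun k a"
  shows "recursive_fun k (\<lambda>xs. triangle (a xs))"
proof -
  have rec: "rec_nat 0 (\<lambda>i r. r + Suc i) j = triangle j" for j :: nat
    by (induction j) auto
  have "recursive_fun 1 (\<lambda>xs. rec_nat 0 (\<lambda>i r. r + Suc i) (hd xs))"
    using recursive_fun.prec[of 0 "\<lambda>xs. 0" "\<lambda>xs. xs ! 1 + Suc (xs ! 0)"]
    by (simp add: recursive_fun.proj recursive_fun.zero recursive_fun_add recursive_fun_Suc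
        del: add_Suc_right)
  from recursive_fun_comp1[OF this assms] show ?thesis by (simp only: rec list.sel)
qed

lemma recursive_fun_prod_encode:
  assumes "recursive_fun k a" "recursive_fun k b"
  shows "recursive_fun k (\<lambda>xs. prod_encode (a xs, b xs))"
  unfolding prod_encode_def
  using assms by (simp add: recursive_fun_add recursive_fun_triangle)

abbreviation nfst :: "nat \<Rightarrow> nat" where "nfst c \<equiv> fst (prod_decode c)"
abbreviation nsnd :: "nat \<Rightarrow> nat" where "nsnd c \<equiv> snd (prod_decode c)"

lemma triangle_mono: "i \<le> j \<Longrightarrow> triangle i \<le> triangle j"
  by (induction rule: dec_induct) auto

text \<open>The codes of the pairs with sum \<open>s\<close> fill the block from
  \<open>triangle s\<close> up to, but excluding, \<open>triangle (Suc s)\<close>. Hence the first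
  block end beyond a code reveals the sum.\<close>

lemma Least_triangle: "(LEAST t. prod_encode (a, b) < triangle (Suc t)) = a + b"
proof (rule Least_equality)
  show "prod_encode (a, b) < triangle (Suc (a + b))"
    by (simp add: prod_encode_def)
  fix t assume t: "prod_encode (a, b) < triangle (Suc t)"
  show "a + b \<le> t"
  proof (rule ccontr)
    assume "\<not> a + b \<le> t"
    then have "triangle (Suc t) \<le> triangle (a + b)"
      by (intro triangle_mono) simp
    with t show False by (simp add: prod_encode_def)
  qed
qed

lemma recursive_fun_prod_decode_sum:
  assumes "recursive_fun k a"
  shows "recursive_fun k (\<lambda>xs. nfst (a xs) + nsnd (a xs))"
proof -
  \<comment> \<open>By truncated subtraction this is 0 iff the code \<open>xs ! 1\<close> lies below
    \<open>triangle (Suc (xs ! 0))\<close>; the search variable is at the head, as \<open>mu\<close>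
    demands.\<close>
  let ?f = "\<lambda>xs. Suc (xs ! 1) - triangle (Suc (xs ! 0))"
  have "recursive_fun (1 + 1) ?f"
    by (intro recursive_fun_diff recursive_fun_Suc recursive_fun_triangle recursive_fun.proj) auto
  \<comment> \<open>Regularity: \<open>triangle (Suc c)\<close> exceeds \<open>c\<close>, so the
    search succeeds at the code itself at the latest.\<close>
  moreover have "\<exists>t. ?f (t # xs) = 0" for xs
    by (rule exI[of _ "xs ! 0"]) simp
  ultimately have "recursive_fun 1 (\<lambda>xs. LEAST t. ?f (t # xs) = 0)"
    by (rule recursive_fun.mu)
  then have "recursive_fun 1 (\<lambda>xs. nfst (xs ! 0) + nsnd (xs ! 0))"
  proof (rule recursive_fun.cong)
    fix xs :: "nat list"
    obtain c d where cd: "xs ! 0 = prod_encode (c, d)"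
      by (metis prod_decode_inverse surj_pair)
    have "(LEAST t. ?f (t # xs) = 0) = (LEAST t. prod_encode (c, d) < triangle (Suc t))"
      by (rule arg_cong[of _ _ Least]) (auto simp: cd simp del: triangle_Suc)
    then show "nfst (xs ! 0) + nsnd (xs ! 0) = (LEAST t. ?f (t # xs) = 0)"
      by (simp only: Least_triangle) (simp add: cd)
  qed
  from recursive_fun_comp1[OF this assms] show ?thesis by simp
qed

text \<open>Once the sum is found by search, subtraction alone recovers the two components.\<close>

lemma prod_decode_eq_sum:
  "nfst c = c - triangle (nfst c + nsnd c)"
  "nsnd c = (nfst c + nsnd c) - nfst c"
proof -
  obtain a b where "c = prod_encode (a, b)"
    by (metis prod_decode_inverse surj_pair)
  then show "nfst c = c - triangle (nfst c + nsnd c)"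
    by simp (simp add: prod_encode_def)
qed simp

lemma recursive_fun_nfst:
  assumes "recursive_fun k a"
  shows "recursive_fun k (\<lambda>xs. nfst (a xs))"
  by (subst prod_decode_eq_sum)
    (intro recursive_fun_diff recursive_fun_triangle recursive_fun_prod_decode_sum assms)

lemma recursive_fun_nsnd:
  assumes "recursive_fun k a"
  shows "recursive_fun k (\<lambda>xs. nsnd (a xs))"
  by (subst prod_decode_eq_sum)
    (intro recursive_fun_diff recursive_fun_nfst recursive_fun_prod_decode_sum assms)

section \<open>Recursive functionals\<close>

lemma recursive_fun_comp_functional:
  assumes "recursive_fun m f" "recursive_functional k m F"
  shows "recursive_fun k (\<lambda>xs. f (F xs))"
proof -
  \<comment> \<open>The rule \<open>comp\<close> wants a list of functions, so \<open>F\<close> is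
    split into its components. The two agree on lists of length \<open>k\<close>, which is all that
    \<open>cong\<close> asks for.\<close>
  let ?gs = "map (\<lambda>i xs. F xs ! i) [0..<m]"
  have "recursive_fun k (\<lambda>xs. f (map (\<lambda>g. g xs) ?gs))"
    using assms by (intro recursive_fun.comp) (auto simp: recursive_functional_def)
  then show ?thesis
  proof (rule recursive_fun.cong)
    fix xs :: "nat list" assume "length xs = k"
    then have "map (\<lambda>g. g xs) ?gs = F xs"
      using assms(2) by (intro nth_equalityI) (auto simp: recursive_functional_def)
    then show "f (F xs) = f (map (\<lambda>g. g xs) ?gs)" by simp
  qed
qed

lemma recursive_functional_comp:
  assumes "recursive_functional m n F" "recursive_functional k m H"
  shows "recursive_functional k n (\<lambda>xs. F (H xs))"
  unfolding recursive_functional_def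
proof (intro conjI allI impI)
  fix i assume "i < n"
  then show "recursive_fun k (\<lambda>xs. F (H xs) ! i)"
    using recursive_fun_comp_functional[OF _ assms(2), of "\<lambda>xs. F xs ! i"] assms(1)
    by (auto simp: recursive_functional_def)
qed (use assms in \<open>auto simp: recursive_functional_def\<close>)

lemma recursive_functional_Nil: "recursive_functional k 0 (\<lambda>xs. [])"
  by (simp add: recursive_functional_def)

lemma recursive_functional_Cons:
  assumes "recursive_fun k a" "recursive_functional k m F"
  shows "recursive_functional k (Suc m) (\<lambda>xs. a xs # F xs)"
  unfolding recursive_functional_def
proof (intro conjI allI impI)
  fix i assume "i < Suc m"
  then show "recursive_fun k (\<lambda>xs. (a xs # F xs) ! i)"
    using assms by (cases i) (auto simp: recursive_functional_def)
qed (use assms in \<open>auto simp: recursive_functional_def\<close>)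

lemma recursive_functional_append:
  assumes "recursive_functional k m F" "recursive_functional k n H"
  shows "recursive_functional k (m + n) (\<lambda>xs. F xs @ H xs)"
  unfolding recursive_functional_def
proof (intro conjI allI impI)
  fix i assume i: "i < m + n"
  show "recursive_fun k (\<lambda>xs. (F xs @ H xs) ! i)"
  proof (cases "i < m")
    case True
    then have "recursive_fun k (\<lambda>xs. F xs ! i)"
      using assms by (auto simp: recursive_functional_def)
    then show ?thesis
      by (rule recursive_fun.cong)
        (use True assms in \<open>auto simp: recursive_functional_def nth_append\<close>)
  next
    case False
    then have "recursive_fun k (\<lambda>xs. H xs ! (i - m))"
      using assms i by (auto simp: recursive_functional_def)
    then show ?thesis
      by (rule recursive_fun.cong)
        (use False assms in \<open>auto simp: recursive_functional_def nth_append\<close>)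
  qed
qed (use assms in \<open>auto simp: recursive_functional_def\<close>)

lemma recursive_functional_tl: "recursive_functional (Suc k) k tl"
  unfolding recursive_functional_def
proof (intro conjI allI impI)
  fix i assume "i < k"
  then have "recursive_fun (Suc k) (\<lambda>xs. xs ! Suc i)"
    by (simp add: recursive_fun.proj)
  then show "recursive_fun (Suc k) (\<lambda>xs. tl xs ! i)"
    by (rule recursive_fun.cong) (use \<open>i < k\<close> in \<open>auto simp: nth_tl\<close>)
qed simp

section \<open>Coding tuples by single numbers\<close>

definition tuple_encode :: "nat list \<Rightarrow> nat" where
  "tuple_encode ys = foldr (\<lambda>a c. prod_encode (a, c)) ys 0"

text \<open>The code does not record the length of the tuple, so \<open>n\<close> has to be
  supplied.\<close>

definition tuple_decode :: "nat \<Rightarrow> nat \<Rightarrow> nat list" where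
  "tuple_decode n c = map (\<lambda>j. nfst ((nsnd ^^ j) c)) [0..<n]"

lemma tuple_decode_encode: "tuple_decode (length ys) (tuple_encode ys) = ys"
proof (rule nth_equalityI)
  fix i assume "i < length (tuple_decode (length ys) (tuple_encode ys))"
  then have "i < length ys"
    by (simp add: tuple_decode_def)
  then have "nfst ((nsnd ^^ i) (tuple_encode ys)) = ys ! i"
  proof (induction ys arbitrary: i)
    case (Cons a ys)
    then show ?case
      by (cases i) (auto simp: tuple_encode_def funpow_Suc_right simp del: funpow.simps(2))
  qed simp
  with \<open>i < length ys\<close> show "tuple_decode (length ys) (tuple_encode ys) ! i = ys ! i"
    by (simp add: tuple_decode_def)
qed (simp add: tuple_decode_def)

text \<open>For fixed \<open>k\<close> the fold is a composition of \<open>k\<close> nested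
  pairings. The downward induction on \<open>j\<close> builds them outwards from the empty suffix at
  \<open>j = k\<close>.\<close>

lemma recursive_fun_tuple_encode: "recursive_fun k tuple_encode"
proof -
  have "recursive_fun k (\<lambda>ys. tuple_encode (drop j ys))" if "j \<le> k" for j
    using that
  proof (induction rule: inc_induct)
    case base
    show ?case
      by (rule recursive_fun.cong[OF recursive_fun.zero]) (simp add: tuple_encode_def)
  next
    case (step j)
    then have "recursive_fun k (\<lambda>ys. prod_encode (ys ! j, tuple_encode (drop (Suc j) ys)))"
      by (intro recursive_fun_prod_encode recursive_fun.proj) auto
    then show ?case
      by (rule recursive_fun.cong)
        (use step in \<open>auto simp: tuple_encode_def Cons_nth_drop_Suc[symmetric]\<close>)
  qed
  from this[of 0] show ?thesis by simp
qed

lemma recursive_functional_tuple_decode: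
  assumes "recursive_fun k a"
  shows "recursive_functional k n (\<lambda>xs. tuple_decode n (a xs))"
proof -
  have "recursive_fun k (\<lambda>xs. (nsnd ^^ j) (a xs))" for j
    by (induction j) (auto intro: assms recursive_fun_nsnd)
  then show ?thesis
    by (auto simp: recursive_functional_def tuple_decode_def intro: recursive_fun_nfst)
qed

section \<open>Closure properties of RE relations\<close>

lemma RE_substitution:
  assumes "RE m A" "recursive_functional k m F"
  shows "RE k {xs. length xs = k \<and> F xs \<in> A}"
proof -
  obtain B where B: "recursive_rel (m + 1) B" "A = {xs. \<exists>t. t # xs \<in> B}"
    using assms(1) by (auto simp: RE_def)
  \<comment> \<open>The existential witness stays at the head; the substitution acts behind
    it.\<close>
  let ?F = "\<lambda>zs. hd zs # F (tl zs)"
  let ?C = "{zs. length zs = k + 1 \<and> ?F zs \<in> B}"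
  have "recursive_functional (k + 1) (m + 1) ?F"
    using recursive_functional_Cons[OF recursive_fun_hd
        recursive_functional_comp[OF assms(2) recursive_functional_tl]] by simp
  from recursive_fun_comp_functional[OF _ this] B(1)
  have "recursive_fun (k + 1) (\<lambda>zs. if ?F zs \<in> B then 1 else 0)"
    by (auto simp: recursive_rel_def)
  then have "recursive_fun (k + 1) (\<lambda>zs. if zs \<in> ?C then 1 else 0)"
    by (rule recursive_fun.cong) simp
  then have "recursive_rel (k + 1) ?C"
    by (auto simp: recursive_rel_def)
  moreover have "{xs. length xs = k \<and> F xs \<in> A} = {xs. \<exists>t. t # xs \<in> ?C}"
    using B(2) by auto
  ultimately show ?thesis
    unfolding RE_def by blast
qed

text \<open>The test is decidable and does not depend on the witness, so the two recursive relations
  under the quantifier can be merged by cases.\<close>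

lemma RE_if_zero:
  assumes "RE k A" "RE k B" "recursive_fun k c"
  shows "RE k {xs. if c xs = 0 then xs \<in> A else xs \<in> B}"
proof -
  obtain A' where A': "recursive_rel (k + 1) A'" "A = {xs. \<exists>t. t # xs \<in> A'}"
    using assms(1) by (auto simp: RE_def)
  obtain B' where B': "recursive_rel (k + 1) B'" "B = {xs. \<exists>t. t # xs \<in> B'}"
    using assms(2) by (auto simp: RE_def)
  let ?C = "{zs. if c (tl zs) = 0 then zs \<in> A' else zs \<in> B'}"
  have "recursive_fun (k + 1) (\<lambda>zs. c (tl zs))"
    using recursive_fun_comp_functional[OF assms(3) recursive_functional_tl] by simp
  then have "recursive_fun (k + 1) (\<lambda>zs. if c (tl zs) = 0 then (if zs \<in> A' then 1 else 0)
      else (if zs \<in> B' then 1 else 0))"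
    using A'(1) B'(1) by (intro recursive_fun_if_zero) (auto simp: recursive_rel_def)
  then have "recursive_fun (k + 1) (\<lambda>zs. if zs \<in> ?C then 1 else 0)"
    by (rule recursive_fun.cong) simp
  then have "recursive_rel (k + 1) ?C"
    using A'(1) B'(1) by (auto simp: recursive_rel_def split: if_splits)
  moreover have "{xs. if c xs = 0 then xs \<in> A else xs \<in> B} = {xs. \<exists>t. t # xs \<in> ?C}"
    unfolding A'(2) B'(2) by (intro Collect_cong) simp
  ultimately show ?thesis
    unfolding RE_def by blast
qed

section \<open>The recursion theorem\<close>

text \<open>Parametrization is applied to the family \<open>S\<close>. It is uniformly RE because
  the enumeration theorem allows the index \<open>nfst q\<close> to be computed from the parameter.
  The tagged list contains \<open>q\<close> and thus that very index, which is the
  self-application.\<close>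

lemma recursive_selfapplication:
  assumes "n \<ge> 1" "acceptable_enumeration n R"
  obtains h where "recursive_fun 1 h"
    and "\<And>q x. length x = n \<Longrightarrow>
      x \<in> R (h [q]) \<longleftrightarrow> prod_encode (q, hd x) # tl x \<in> R (nfst q)"
proof -
  define S where "S q = {x. length x = n \<and> prod_encode (q, hd x) # tl x \<in> R (nfst q)}" for q
  obtain m where n: "n = Suc m"
    using assms(1) by (cases n) auto
  let ?U = "{i # xs | i xs. xs \<in> R i}"
  \<comment> \<open>Here \<open>zs\<close> is \<open>q # x\<close>, so \<open>zs ! 1\<close> is
    \<open>hd x\<close> and \<open>tl (tl zs)\<close> is \<open>tl x\<close>.\<close>
  let ?F = "\<lambda>zs. nfst (zs ! 0) # prod_encode (zs ! 0, zs ! 1) # tl (tl zs)"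
  have "RE (n + 1) ?U"
    using assms(2) by (simp add: acceptable_enumeration_def uniformly_RE_def)
  moreover have "recursive_functional (n + 1) (n + 1) ?F"
    unfolding n
    using recursive_functional_comp[OF recursive_functional_tl recursive_functional_tl]
    by (auto intro!: recursive_functional_Cons recursive_fun_nfst recursive_fun_prod_encode
        recursive_fun.proj)
  ultimately have "RE (n + 1) {zs. length zs = n + 1 \<and> ?F zs \<in> ?U}"
    by (rule RE_substitution)
  moreover have "{zs. length zs = n + 1 \<and> ?F zs \<in> ?U} = {q # x | q x. x \<in> S q}"
  proof (rule set_eqI)
    fix zs
    show "zs \<in> {zs. length zs = n + 1 \<and> ?F zs \<in> ?U} \<longleftrightarrow> zs \<in> {q # x | q x. x \<in> S q}"
      by (cases zs; cases "tl zs") (auto simp: S_def n)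
  qed
  ultimately have "uniformly_RE n S"
    by (simp add: uniformly_RE_def)
  then obtain h where h: "recursive_fun 1 h" "\<And>i. S i = R (h [i])"
    using assms(2) by (auto simp: acceptable_enumeration_def)
  then show ?thesis
    by (intro that[of h]) (auto simp: h(2)[symmetric] S_def)
qed

theorem theorem4p3:
  fixes n :: nat
    and R :: "nat \<Rightarrow> nat list set"
    and M1 M2 :: "nat list set"
    and G :: "nat list \<Rightarrow> nat list"
  assumes "n \<ge> 1"
    and "acceptable_enumeration n R"
    and "RE (3 * n) M1"
    and "RE (3 * n) M2"
    and "recursive_functional 2 n G"
  shows "\<exists>f1 f2. recursive_fun n f1 \<and> recursive_fun n f2 \<and>
    (\<forall>y x. length y = n \<longrightarrow> length x = n \<longrightarrow>
      (x \<in> R (f1 y) \<longleftrightarrow> x @ y @ G [f1 y, f2 y] \<in> M1) \<and>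
      (x \<in> R (f2 y) \<longleftrightarrow> x @ y @ G [f1 y, f2 y] \<in> M2))"
proof -
  obtain h where h: "recursive_fun 1 h"
    and R_h: "\<And>q x. length x = n \<Longrightarrow>
      x \<in> R (h [q]) \<longleftrightarrow> prod_encode (q, hd x) # tl x \<in> R (nfst q)"
    using recursive_selfapplication[OF assms(1,2)] by blast
  obtain m where n: "n = Suc m"
    using assms(1) by (cases n) auto
  \<comment> \<open>The index \<open>e\<close> is still a free parameter; \<open>c\<close> stands
    for the code of \<open>y\<close>.\<close>
  define f where "f i e c = h [prod_encode (e, prod_encode (i, c))]" for i e c
  have rec_f: "recursive_fun k (\<lambda>xs. f i (a xs) (b xs))"
    if "recursive_fun k a" "recursive_fun k b" for i k a b
    unfolding f_def
    by (intro recursive_fun_comp1[OF h] recursive_fun_prod_encode recursive_fun_const that)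
  \<comment> \<open>The argument \<open>z\<close> is read as a tagged list:
    \<open>nfst (hd z)\<close> is the tag, and \<open>e'\<close>, \<open>i\<close> and
    \<open>c\<close> are its components.\<close>
  define e' where "e' z = nfst (nfst (hd z))" for z
  define i where "i z = nfst (nsnd (nfst (hd z)))" for z
  define c where "c z = nsnd (nsnd (nfst (hd z)))" for z
  have rec_hd: "recursive_fun n hd"
    using assms(1) by (rule recursive_fun_hd)
  have rec: "recursive_fun n e'" "recursive_fun n i" "recursive_fun n c"
    unfolding e'_def i_def c_def by (intro recursive_fun_nfst recursive_fun_nsnd rec_hd)+
  \<comment> \<open>Removing the tag restores \<open>x\<close>, and decoding \<open>c z\<close>
    restores \<open>y\<close>.\<close>
  define K where "K z = (nsnd (hd z) # tl z) @ tuple_decode n (c z) @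
    G [f 0 (e' z) (c z), f 1 (e' z) (c z)]" for z
  have "recursive_functional n n (\<lambda>z. nsnd (hd z) # tl z)"
    using rec_hd unfolding n
    by (intro recursive_functional_Cons recursive_fun_nsnd recursive_functional_tl)
  moreover have "recursive_functional n 2 (\<lambda>z. [f 0 (e' z) (c z), f 1 (e' z) (c z)])"
    unfolding numeral_2_eq_2
    by (intro recursive_functional_Cons recursive_functional_Nil rec_f rec)
  ultimately have "recursive_functional n (n + (n + n)) K"
    unfolding K_def
    by (intro recursive_functional_append recursive_functional_tuple_decode rec
        recursive_functional_comp[OF assms(5)])
  then have rec_K: "recursive_functional n (3 * n) K"
    by (simp add: numeral_3_eq_3 add_ac)
  \<comment> \<open>One set holds both relations, selected by the tag, so that a single index yields
    both fixed points at once.\<close>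
  define A where "A = {z. if i z = 0 then z \<in> {z. length z = n \<and> K z \<in> M1}
    else z \<in> {z. length z = n \<and> K z \<in> M2}}"
  have "RE n A"
    unfolding A_def
    by (intro RE_if_zero rec RE_substitution[OF assms(3) rec_K] RE_substitution[OF assms(4) rec_K])
  \<comment> \<open>The circle closes here: \<open>A\<close> takes the index from the tag instead of
    mentioning a fixed one, so its own index may be put into the tag.\<close>
  then obtain e where e: "R e = A"
    using assms(2) unfolding acceptable_enumeration_def by (metis mem_Collect_eq rangeE)
  have fixpoint: "x \<in> R (f j e (tuple_encode y)) \<longleftrightarrow>
      x @ y @ G [f 0 e (tuple_encode y), f 1 e (tuple_encode y)] \<in> (if j = 0 then M1 else M2)"
    if len: "length y = n" "length x = n" for x y j
  proof -
    obtain a xs where x: "x = a # xs"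
      using len(2) n by (cases x) auto
    \<comment> \<open>This is \<open>x\<close> tagged with the number to which
      \<open>f j e (tuple_encode y)\<close> applies \<open>h\<close>.\<close>
    define z where "z = prod_encode (prod_encode (e, prod_encode (j, tuple_encode y)), a) # xs"
    have "K z = x @ y @ G [f 0 e (tuple_encode y), f 1 e (tuple_encode y)]"
      using tuple_decode_encode[of y] len(1) by (simp add: K_def z_def x c_def e'_def)
    moreover have "i z = j" "length z = n"
      using len(2) by (auto simp: i_def z_def x)
    moreover have "x \<in> R (f j e (tuple_encode y)) \<longleftrightarrow> z \<in> A"
      using R_h[OF len(2)] by (simp add: f_def e z_def x)
    ultimately show ?thesis
      by (simp add: A_def)
  qed
  show ?thesis
  proof (intro exI conjI allI impI)
    show "recursive_fun n (\<lambda>y. f 0 e (tuple_encode y))" "recursive_fun n (\<lambda>y. f 1 e (tuple_encode y))"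
      by (intro rec_f recursive_fun_const recursive_fun_tuple_encode)+
  qed (use fixpoint in auto)
qed

end
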